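(* Let $U$ be a nonempty set. For every MSO formula $\varphi$, range-relative validity over $U$ coincides with general (Henkin-style) validity over $U$: $$\bigl(\forall I\ \forall g\ \forall G.\ \langle I,\mathrm{Range}(g),\mathrm{Range}(G)\rangle,g,G\models^d\varphi\bigr)\iff\ \models^d\varphi ,$$ where $I$ ranges over all interpretations over $U$, $g$ over all maps $V\to U$ and $G$ over all maps $V_2\to\mathcal P(U)$. Equivalently, the minimal-shallow embedding is faithful exactly to general validity: $\models^d\varphi$ holds if and only if the proposition $(\!|\varphi|\!)_{II,gg,GG}$ is true for every interpretation $II$ over $U$, every $gg:V\to U$ and every $GG:V_2\to\mathcal P(U)$.
   Context: **Syntax.** Relation symbols $R=\mathbb N$, first-order variables $V=\mathbb N$ and second-order (monadic) variables $V_2=\mathbb N$ (the two kinds of variables form separate namespaces). MSO formulas: $\varphi,\psi ::= r(x,y)\mid X(x)\mid\neg\varphi\mid\varphi\wedge\psi\mid\exists x.\varphi\mid\exists X.\varphi$ with $r\in R$, $x,y\in V$, $X\in V_2$ (no equality). **Semantics.** $U$ is a fixed nonempty set (the type of individuals). An interpretation $I$ over $U$ assigns to each $r\in R$ a binary relation $I(r)\subseteq U\times U$. Given $I$, a set $D\subseteq U$, a family $E\subseteq\mathcal P(U)$ (no closure condition on $E$), and assignments $g:V\to U$, $G:V_2\to\mathcal P(U)$, truth $\langle I,D,E\rangle,g,G\models^d\varphi$ is defined recursively: $r(x,y)$ holds iff $(g(x),g(y))\in I(r)$; $X(x)$ holds iff $g(x)\in G(X)$; $\neg,\wedge$ are classical;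 $\exists x.\varphi$ holds iff $\langle I,D,E\rangle,g[x\leftarrow d],G\models^d\varphi$ for some $d\in D$; $\exists X.\varphi$ holds iff $\langle I,D,E\rangle,g,G\langle X\leftarrow S\rangle\models^d\varphi$ for some $S\in E$. Here $g[x\leftarrow d]$ and $G\langle X\leftarrow S\rangle$ are the usual updates. **General validity.** $\models^d\varphi$ means: for all $I$, $D\subseteq U$, $E\subseteq\mathcal P(U)$, all $g$ with $\mathrm{Range}(g)\subseteq D$ and all $G$ with $\mathrm{Range}(G)\subseteq E$, $\langle I,D,E\rangle,g,G\models^d\varphi$. **Safe substitution.** $[x\leftarrow_r z](\varphi)$ (for $x,z\in V$) is capture-avoiding substitution: first rename every binder $\exists z$ in $\varphi$, together with the occurrences it binds, to $\exists w$ for a fresh variable $w$ (say the least one not occurring in $\varphi$ and different from $x,z$), then replace all free occurrences of $x$ by $z$. $[X\leftarrow_{r2}Z](\varphi)$ for $X,Z\in V_2$ is the analogous operation for second-order variables. Binders of one namespace do not interact with substitution in the other. Both operations preserve formula size. **Minimal-shallow translation.** For parameters $II$ (an interpretation over $U$), $gg:V\to U$, $GG:V_2\to\mathcal P(U)$, the truth value $(\!|\varphi|\!)=(\!|\varphi|\!)_{II,gg,GG}$ is defined by recursion on formula size: $(\!|r(x,y)|\!)$ is $(gg(x),gg(y))\in II(r)$; $(\!|X(x)|\!)$ is $gg(x)\in GG(X)$; $(\!|\neg\varphi|\!)$ is $\neg(\!|\varphi|\!)$; $(\!|\varphi\wedge\psi|\!)$ is $(\!|\varphi|\!)\wedge(\!|\psi|\!)$;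 $(\!|\exists x.\varphi|\!)$ is "there is a variable $z\in V$ with $(\!|[x\leftarrow_r z](\varphi)|\!)$"; $(\!|\exists X.\varphi|\!)$ is "there is a variable $Z\in V_2$ with $(\!|[X\leftarrow_{r2}Z](\varphi)|\!)$". *)

theory Defs
  imports Main
begin

type_synonym rsym = nat
type_synonym var = nat
type_synonym var2 = nat

datatype mso =
    Rel rsym var var
  | In var2 var
  | Neg mso
  | Conj mso mso
  | Ex var mso
  | Ex2 var2 mso

type_synonym 'u interp = "rsym \<Rightarrow> ('u \<times> 'u) set"

text \<open>The nonempty set of individuals is the type \<open>'u\<close>; no closure condition is imposed on
  the range \<open>E\<close> of the second-order quantifiers.\<close>

primrec sat :: "'u interp \<times> 'u set \<times> 'u set set \<Rightarrow> (var \<Rightarrow> 'u) \<Rightarrow> (var2 \<Rightarrow> 'u set) \<Rightarrow> mso \<Rightarrow> bool"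
    ("_, _, _ \<Turnstile>\<^sup>d _" [51, 51, 51, 51] 50) where
  "(M, g, G \<Turnstile>\<^sup>d Rel r x y) \<longleftrightarrow> (g x, g y) \<in> fst M r"
| "(M, g, G \<Turnstile>\<^sup>d In X x) \<longleftrightarrow> g x \<in> G X"
| "(M, g, G \<Turnstile>\<^sup>d Neg \<phi>) \<longleftrightarrow> \<not> (M, g, G \<Turnstile>\<^sup>d \<phi>)"
| "(M, g, G \<Turnstile>\<^sup>d Conj \<phi> \<psi>) \<longleftrightarrow> (M, g, G \<Turnstile>\<^sup>d \<phi>) \<and> (M, g, G \<Turnstile>\<^sup>d \<psi>)"
| "(M, g, G \<Turnstile>\<^sup>d Ex x \<phi>) \<longleftrightarrow> (\<exists>d \<in> fst (snd M). (M, g(x := d), G \<Turnstile>\<^sup>d \<phi>))"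
| "(M, g, G \<Turnstile>\<^sup>d Ex2 X \<phi>) \<longleftrightarrow> (\<exists>S \<in> snd (snd M). (M, g, G(X := S) \<Turnstile>\<^sup>d \<phi>))"

text \<open>Validity depends on the set of individuals, which is passed as a type argument.\<close>

definition general_valid :: "'u itself \<Rightarrow> mso \<Rightarrow> bool" where
  "general_valid (_ :: 'u itself) \<phi> \<longleftrightarrow>
    (\<forall>(I :: 'u interp) D E g G. range g \<subseteq> D \<longrightarrow> range G \<subseteq> E \<longrightarrow> ((I, D, E), g, G \<Turnstile>\<^sup>d \<phi>))"

text \<open>All variables occurring in a formula: free, bound, or at a binder.\<close>

primrec vars :: "mso \<Rightarrow> var set" where
  "vars (Rel r x y) = {x, y}"
| "vars (In X x) = {x}"
| "vars (Neg \<phi>) = vars \<phi>"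
| "vars (Conj \<phi> \<psi>) = vars \<phi> \<union> vars \<psi>"
| "vars (Ex x \<phi>) = insert x (vars \<phi>)"
| "vars (Ex2 X \<phi>) = vars \<phi>"

primrec vars2 :: "mso \<Rightarrow> var2 set" where
  "vars2 (Rel r x y) = {}"
| "vars2 (In X x) = {X}"
| "vars2 (Neg \<phi>) = vars2 \<phi>"
| "vars2 (Conj \<phi> \<psi>) = vars2 \<phi> \<union> vars2 \<psi>"
| "vars2 (Ex x \<phi>) = vars2 \<phi>"
| "vars2 (Ex2 X \<phi>) = insert X (vars2 \<phi>)"

text \<open>\<open>replace_free x z \<phi>\<close> replaces the free occurrences of \<open>x\<close> by \<open>z\<close> without any check for
  capture.\<close>

primrec replace_free :: "var \<Rightarrow> var \<Rightarrow> mso \<Rightarrow> mso" where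
  "replace_free x z (Rel r u v) = Rel r (if u = x then z else u) (if v = x then z else v)"
| "replace_free x z (In X u) = In X (if u = x then z else u)"
| "replace_free x z (Neg \<phi>) = Neg (replace_free x z \<phi>)"
| "replace_free x z (Conj \<phi> \<psi>) = Conj (replace_free x z \<phi>) (replace_free x z \<psi>)"
| "replace_free x z (Ex u \<phi>) = Ex u (if u = x then \<phi> else replace_free x z \<phi>)"
| "replace_free x z (Ex2 X \<phi>) = Ex2 X (replace_free x z \<phi>)"

primrec replace_free2 :: "var2 \<Rightarrow> var2 \<Rightarrow> mso \<Rightarrow> mso" where
  "replace_free2 X Z (Rel r u v) = Rel r u v"
| "replace_free2 X Z (In Y u) = In (if Y = X then Z else Y) u"
| "replace_free2 X Z (Neg \<phi>) = Neg (replace_free2 X Z \<phi>)"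
| "replace_free2 X Z (Conj \<phi> \<psi>) = Conj (replace_free2 X Z \<phi>) (replace_free2 X Z \<psi>)"
| "replace_free2 X Z (Ex u \<phi>) = Ex u (replace_free2 X Z \<phi>)"
| "replace_free2 X Z (Ex2 Y \<phi>) = Ex2 Y (if Y = X then \<phi> else replace_free2 X Z \<phi>)"

text \<open>\<open>rename_bound z w \<phi>\<close> renames every binder of \<open>z\<close>, with the occurrences it binds, to \<open>w\<close>.
  Inner binders are renamed first, so that each occurrence follows its own binder; this is
  meaningful only if \<open>w\<close> does not occur in \<open>\<phi>\<close>.\<close>

primrec rename_bound :: "var \<Rightarrow> var \<Rightarrow> mso \<Rightarrow> mso" where
  "rename_bound z w (Rel r u v) = Rel r u v"
| "rename_bound z w (In X u) = In X u"
| "rename_bound z w (Neg \<phi>) = Neg (rename_bound z w \<phi>)"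
| "rename_bound z w (Conj \<phi> \<psi>) = Conj (rename_bound z w \<phi>) (rename_bound z w \<psi>)"
| "rename_bound z w (Ex u \<phi>) =
    (if u = z then Ex w (replace_free z w (rename_bound z w \<phi>)) else Ex u (rename_bound z w \<phi>))"
| "rename_bound z w (Ex2 X \<phi>) = Ex2 X (rename_bound z w \<phi>)"

primrec rename_bound2 :: "var2 \<Rightarrow> var2 \<Rightarrow> mso \<Rightarrow> mso" where
  "rename_bound2 Z W (Rel r u v) = Rel r u v"
| "rename_bound2 Z W (In X u) = In X u"
| "rename_bound2 Z W (Neg \<phi>) = Neg (rename_bound2 Z W \<phi>)"
| "rename_bound2 Z W (Conj \<phi> \<psi>) = Conj (rename_bound2 Z W \<phi>) (rename_bound2 Z W \<psi>)"
| "rename_bound2 Z W (Ex u \<phi>) = Ex u (rename_bound2 Z W \<phi>)"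
| "rename_bound2 Z W (Ex2 X \<phi>) =
    (if X = Z then Ex2 W (replace_free2 Z W (rename_bound2 Z W \<phi>)) else Ex2 X (rename_bound2 Z W \<phi>))"

definition fresh :: "var \<Rightarrow> var \<Rightarrow> mso \<Rightarrow> var" where
  "fresh x z \<phi> = (LEAST w. w \<notin> vars \<phi> \<and> w \<noteq> x \<and> w \<noteq> z)"

definition fresh2 :: "var2 \<Rightarrow> var2 \<Rightarrow> mso \<Rightarrow> var2" where
  "fresh2 X Z \<phi> = (LEAST W. W \<notin> vars2 \<phi> \<and> W \<noteq> X \<and> W \<noteq> Z)"

definition subst :: "var \<Rightarrow> var \<Rightarrow> mso \<Rightarrow> mso" ("[_ \<leftarrow>\<^sub>r _]'(_')") where
  "[x \<leftarrow>\<^sub>r z](\<phi>) = replace_free x z (rename_bound z (fresh x z \<phi>) \<phi>)"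

definition subst2 :: "var2 \<Rightarrow> var2 \<Rightarrow> mso \<Rightarrow> mso" ("[_ \<leftarrow>\<^sub>r\<^sub>2 _]'(_')") where
  "[X \<leftarrow>\<^sub>r\<^sub>2 Z](\<phi>) = replace_free2 X Z (rename_bound2 Z (fresh2 X Z \<phi>) \<phi>)"

primrec fsize :: "mso \<Rightarrow> nat" where
  "fsize (Rel r x y) = 1"
| "fsize (In X x) = 1"
| "fsize (Neg \<phi>) = Suc (fsize \<phi>)"
| "fsize (Conj \<phi> \<psi>) = Suc (fsize \<phi> + fsize \<psi>)"
| "fsize (Ex x \<phi>) = Suc (fsize \<phi>)"
| "fsize (Ex2 X \<phi>) = Suc (fsize \<phi>)"

lemma fsize_replace_free [simp]:
  "fsize (replace_free x z \<phi>) = fsize \<phi>" "fsize (replace_free2 X Z \<phi>) = fsize \<phi>"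
  by (induction \<phi>) auto

lemma fsize_rename_bound [simp]:
  "fsize (rename_bound z w \<phi>) = fsize \<phi>" "fsize (rename_bound2 Z W \<phi>) = fsize \<phi>"
  by (induction \<phi>) auto

lemma fsize_subst [simp]: "fsize [x \<leftarrow>\<^sub>r z](\<phi>) = fsize \<phi>" "fsize [X \<leftarrow>\<^sub>r\<^sub>2 Z](\<phi>) = fsize \<phi>"
  by (simp_all add: subst_def subst2_def)

text \<open>In the minimal-shallow translation the quantifiers range over variables rather than over
  individuals or sets.\<close>

function min_shallow :: "'u interp \<Rightarrow> (var \<Rightarrow> 'u) \<Rightarrow> (var2 \<Rightarrow> 'u set) \<Rightarrow> mso \<Rightarrow> bool" where
  "min_shallow II gg GG (Rel r x y) \<longleftrightarrow> (gg x, gg y) \<in> II r"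
| "min_shallow II gg GG (In X x) \<longleftrightarrow> gg x \<in> GG X"
| "min_shallow II gg GG (Neg \<phi>) \<longleftrightarrow> \<not> min_shallow II gg GG \<phi>"
| "min_shallow II gg GG (Conj \<phi> \<psi>) \<longleftrightarrow> min_shallow II gg GG \<phi> \<and> min_shallow II gg GG \<psi>"
| "min_shallow II gg GG (Ex x \<phi>) \<longleftrightarrow> (\<exists>z. min_shallow II gg GG [x \<leftarrow>\<^sub>r z](\<phi>))"
| "min_shallow II gg GG (Ex2 X \<phi>) \<longleftrightarrow> (\<exists>Z. min_shallow II gg GG [X \<leftarrow>\<^sub>r\<^sub>2 Z](\<phi>))"
  by pat_completeness auto
termination
  by (relation "measure (\<lambda>(_, _, _, \<phi>). fsize \<phi>)") auto

end

(* A range-relative model whose ranges are arbitrary countable nonempty sets is the same as a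
   Henkin model with countable domains, so the first equivalence is a two-sorted downward
   Loewenheim-Skolem theorem: the values of Skolem terms form an elementary substructure, and since
   a formula has finitely many variables, the remaining ones can be used to enumerate it. The second
   equivalence holds pointwise: over the ranges of the assignments, quantifying over elements is
   quantifying over variables that are substituted for the bound one. *)
theory Submission
  imports Defs "HOL-Library.Countable_Set"
begin

section \<open>Dependence of truth on the occurring variables\<close>

lemma finite_vars [simp]: "finite (vars \<phi>)" "finite (vars2 \<phi>)"
  by (induction \<phi>) auto

lemma sat_cong:
  assumes "\<And>x. x \<in> vars \<phi> \<Longrightarrow> g x = g' x" and "\<And>X. X \<in> vars2 \<phi> \<Longrightarrow> G X = G' X"
  shows "(M, g, G \<Turnstile>\<^sup>d \<phi>) \<longleftrightarrow> (M, g', G' \<Turnstile>\<^sup>d \<phi>)"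
  using assms
proof (induction \<phi> arbitrary: g g' G G')
  case (Neg \<phi>)
  have "(M, g, G \<Turnstile>\<^sup>d \<phi>) \<longleftrightarrow> (M, g', G' \<Turnstile>\<^sup>d \<phi>)"
    by (rule Neg.IH) (use Neg.prems in auto)
  then show ?case by simp
next
  case (Conj \<phi> \<psi>)
  have "(M, g, G \<Turnstile>\<^sup>d \<phi>) \<longleftrightarrow> (M, g', G' \<Turnstile>\<^sup>d \<phi>)"
    by (rule Conj.IH) (use Conj.prems in auto)
  moreover have "(M, g, G \<Turnstile>\<^sup>d \<psi>) \<longleftrightarrow> (M, g', G' \<Turnstile>\<^sup>d \<psi>)"
    by (rule Conj.IH) (use Conj.prems in auto)
  ultimately show ?case by simp
next
  case (Ex x \<phi>)
  have "(M, g(x := d), G \<Turnstile>\<^sup>d \<phi>) \<longleftrightarrow> (M, g'(x := d), G' \<Turnstile>\<^sup>d \<phi>)" for d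
    by (rule Ex.IH) (use Ex.prems in auto)
  then show ?case by simp
next
  case (Ex2 X \<phi>)
  have "(M, g, G(X := S) \<Turnstile>\<^sup>d \<phi>) \<longleftrightarrow> (M, g', G'(X := S) \<Turnstile>\<^sup>d \<phi>)" for S
    by (rule Ex2.IH) (use Ex2.prems in auto)
  then show ?case by simp
qed simp_all

subsection \<open>Substitution\<close>

primrec bound_vars :: "mso \<Rightarrow> var set" where
  "bound_vars (Rel r x y) = {}"
| "bound_vars (In X x) = {}"
| "bound_vars (Neg \<phi>) = bound_vars \<phi>"
| "bound_vars (Conj \<phi> \<psi>) = bound_vars \<phi> \<union> bound_vars \<psi>"
| "bound_vars (Ex x \<phi>) = insert x (bound_vars \<phi>)"
| "bound_vars (Ex2 X \<phi>) = bound_vars \<phi>"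

primrec bound_vars2 :: "mso \<Rightarrow> var2 set" where
  "bound_vars2 (Rel r x y) = {}"
| "bound_vars2 (In X x) = {}"
| "bound_vars2 (Neg \<phi>) = bound_vars2 \<phi>"
| "bound_vars2 (Conj \<phi> \<psi>) = bound_vars2 \<phi> \<union> bound_vars2 \<psi>"
| "bound_vars2 (Ex x \<phi>) = bound_vars2 \<phi>"
| "bound_vars2 (Ex2 X \<phi>) = insert X (bound_vars2 \<phi>)"

lemma bound_vars_replace_free [simp]: "bound_vars (replace_free x z \<phi>) = bound_vars \<phi>"
  by (induction \<phi>) auto

lemma bound_vars2_replace_free2 [simp]: "bound_vars2 (replace_free2 X Z \<phi>) = bound_vars2 \<phi>"
  by (induction \<phi>) auto

lemma bound_vars_rename_bound: "w \<noteq> z \<Longrightarrow> z \<notin> bound_vars (rename_bound z w \<phi>)"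
  by (induction \<phi>) auto

lemma bound_vars2_rename_bound2: "W \<noteq> Z \<Longrightarrow> Z \<notin> bound_vars2 (rename_bound2 Z W \<phi>)"
  by (induction \<phi>) auto

text \<open>With no binder of \<open>z\<close>, every quantifier passed leaves \<open>g z\<close>
  intact, so the update at \<open>x\<close> commutes with it; a binder of \<open>x\<close>
  overwrites that update.\<close>

lemma sat_replace_free:
  assumes "z \<notin> bound_vars \<phi>"
  shows "(M, g, G \<Turnstile>\<^sup>d replace_free x z \<phi>) \<longleftrightarrow> (M, g(x := g z), G \<Turnstile>\<^sup>d \<phi>)"
  using assms by (induction \<phi> arbitrary: g G) (auto simp: fun_upd_twist)

lemma sat_replace_free2:
  assumes "Z \<notin> bound_vars2 \<phi>"
  shows "(M, g, G \<Turnstile>\<^sup>d replace_free2 X Z \<phi>) \<longleftrightarrow> (M, g, G(X := G Z) \<Turnstile>\<^sup>d \<phi>)"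
  using assms by (induction \<phi> arbitrary: g G) (auto simp: fun_upd_twist)

text \<open>Below a binder renamed by \<open>rename_bound\<close>, \<open>z\<close> has already been
  replaced by \<open>w\<close>; this absorbs a second replacement coming from outside.\<close>

lemma replace_free_idem [simp]:
  "z \<noteq> w \<Longrightarrow> replace_free z w (replace_free z w \<phi>) = replace_free z w \<phi>"
  by (induction \<phi>) auto

lemma replace_free2_idem [simp]:
  "Z \<noteq> W \<Longrightarrow> replace_free2 Z W (replace_free2 Z W \<phi>) = replace_free2 Z W \<phi>"
  by (induction \<phi>) auto

text \<open>Renaming nested binders of \<open>z\<close> makes \<open>w\<close> a bound variable, so \<open>sat_replace_free\<close> does not
  apply to the replacement inside \<open>rename_bound\<close>; the second claim takes its place.\<close>

lemma sat_rename_bound_aux: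
  assumes "w \<notin> vars \<phi>" "w \<noteq> z"
  shows "((M, g, G \<Turnstile>\<^sup>d rename_bound z w \<phi>) \<longleftrightarrow> (M, g, G \<Turnstile>\<^sup>d \<phi>)) \<and>
    ((M, g, G \<Turnstile>\<^sup>d replace_free z w (rename_bound z w \<phi>)) \<longleftrightarrow> (M, g(z := g w), G \<Turnstile>\<^sup>d \<phi>))"
  using assms
proof (induction \<phi> arbitrary: g G)
  case (Ex u \<phi>)
  \<comment> \<open>Below a renamed binder the witness \<open>d\<close> sits at \<open>w\<close> and
    the replacement copies it to \<open>z\<close>, whence the double update.\<close>
  have unused: "(M, g(w := d, z := d), G \<Turnstile>\<^sup>d \<phi>) \<longleftrightarrow> (M, g(z := d), G \<Turnstile>\<^sup>d \<phi>)" for d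
    by (rule sat_cong) (use Ex.prems in auto)
  have "w \<notin> vars \<phi>" "w \<noteq> u"
    using Ex.prems by auto
  note IH = Ex.IH[OF this(1) Ex.prems(2)]
  show ?case
    using \<open>w \<noteq> u\<close> Ex.prems(2) by (cases "u = z") (simp_all add: IH unused fun_upd_twist fun_upd_same fun_upd_other del: fun_upd_apply)
qed auto

lemma sat_rename_bound2_aux:
  assumes "W \<notin> vars2 \<phi>" "W \<noteq> Z"
  shows "((M, g, G \<Turnstile>\<^sup>d rename_bound2 Z W \<phi>) \<longleftrightarrow> (M, g, G \<Turnstile>\<^sup>d \<phi>)) \<and>
    ((M, g, G \<Turnstile>\<^sup>d replace_free2 Z W (rename_bound2 Z W \<phi>)) \<longleftrightarrow> (M, g, G(Z := G W) \<Turnstile>\<^sup>d \<phi>))"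
  using assms
proof (induction \<phi> arbitrary: g G)
  case (Ex2 Y \<phi>)
  have unused: "(M, g, G(W := S, Z := S) \<Turnstile>\<^sup>d \<phi>) \<longleftrightarrow> (M, g, G(Z := S) \<Turnstile>\<^sup>d \<phi>)" for S
    by (rule sat_cong) (use Ex2.prems in auto)
  have "W \<notin> vars2 \<phi>" "W \<noteq> Y"
    using Ex2.prems by auto
  note IH = Ex2.IH[OF this(1) Ex2.prems(2)]
  show ?case
    using \<open>W \<noteq> Y\<close> Ex2.prems(2) by (cases "Y = Z") (simp_all add: IH unused fun_upd_twist fun_upd_same fun_upd_other del: fun_upd_apply)
qed auto

lemma fresh: "fresh x z \<phi> \<notin> vars \<phi>" "fresh x z \<phi> \<noteq> z"
proof -
  have "\<exists>w. w \<notin> insert x (insert z (vars \<phi>))"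
    by (rule ex_new_if_finite) auto
  then have "\<exists>w. w \<notin> vars \<phi> \<and> w \<noteq> x \<and> w \<noteq> z"
    by auto
  from LeastI_ex[OF this] show "fresh x z \<phi> \<notin> vars \<phi>" "fresh x z \<phi> \<noteq> z"
    unfolding fresh_def by auto
qed

lemma fresh2: "fresh2 X Z \<phi> \<notin> vars2 \<phi>" "fresh2 X Z \<phi> \<noteq> Z"
proof -
  have "\<exists>W. W \<notin> insert X (insert Z (vars2 \<phi>))"
    by (rule ex_new_if_finite) auto
  then have "\<exists>W. W \<notin> vars2 \<phi> \<and> W \<noteq> X \<and> W \<noteq> Z"
    by auto
  from LeastI_ex[OF this] show "fresh2 X Z \<phi> \<notin> vars2 \<phi>" "fresh2 X Z \<phi> \<noteq> Z"
    unfolding fresh2_def by auto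
qed

lemma sat_subst: "(M, g, G \<Turnstile>\<^sup>d [x \<leftarrow>\<^sub>r z](\<phi>)) \<longleftrightarrow> (M, g(x := g z), G \<Turnstile>\<^sup>d \<phi>)"
  by (simp add: subst_def sat_replace_free bound_vars_rename_bound fresh sat_rename_bound_aux)

lemma sat_subst2: "(M, g, G \<Turnstile>\<^sup>d [X \<leftarrow>\<^sub>r\<^sub>2 Z](\<phi>)) \<longleftrightarrow> (M, g, G(X := G Z) \<Turnstile>\<^sup>d \<phi>)"
  by (simp add: subst2_def sat_replace_free2 bound_vars2_rename_bound2 fresh2 sat_rename_bound2_aux)

text \<open>Elements of the ranges are exactly the values of variables, and updating
  \<open>x\<close> to the value of \<open>z\<close> amounts to substituting \<open>z\<close>. The
  induction follows the recursion of \<open>min_shallow\<close>, because a substitution instance is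
  in general not a subformula.\<close>

lemma min_shallow_iff_sat:
  "min_shallow II gg GG \<phi> \<longleftrightarrow> ((II, range gg, range GG), gg, GG \<Turnstile>\<^sup>d \<phi>)"
  by (induction II gg GG \<phi> rule: min_shallow.induct) (simp_all add: sat_subst sat_subst2)

subsection \<open>The Skolem hull\<close>

instance mso :: countable
  by countable_datatype

text \<open>Skolem terms serve both sorts at once: the value of a term is a pair of an individual and a
  set. In \<open>Witness x \<phi> ts Ts\<close> the two lists describe the assignments at which a witness for
  \<open>Ex x \<phi>\<close> or \<open>Ex2 x \<phi>\<close> is sought.\<close>

datatype skolem = Base nat | Witness nat mso "skolem list" "skolem list"

instance skolem :: countable
  by countable_datatype

text \<open>A finite list fixes an initial segment of an assignment and \<open>f\<close> supplies
  the tail. Skolem terms thus stay finite objects, so there are only countably many.\<close>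

definition override :: "(nat \<Rightarrow> 'a) \<Rightarrow> 'a list \<Rightarrow> nat \<Rightarrow> 'a" where
  "override f xs n = (if n < length xs then xs ! n else f n)"

text \<open>The fallbacks \<open>g 0\<close> and \<open>G 0\<close> keep the values inside any
  \<open>D\<close> and \<open>E\<close> containing the ranges when there is no witness.\<close>

primrec skolem_value ::
  "'u interp \<times> 'u set \<times> 'u set set \<Rightarrow> (var \<Rightarrow> 'u) \<Rightarrow> (var2 \<Rightarrow> 'u set) \<Rightarrow> skolem \<Rightarrow> 'u \<times> 'u set"
where
  "skolem_value M g G (Base i) = (g i, G i)"
| "skolem_value M g G (Witness x \<phi> ts Ts) =
    (let h = override g (map fst (map (skolem_value M g G) ts));
         H = override G (map snd (map (skolem_value M g G) Ts))
     in (if \<exists>d \<in> fst (snd M). (M, h(x := d), H \<Turnstile>\<^sup>d \<phi>)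
         then SOME d. d \<in> fst (snd M) \<and> (M, h(x := d), H \<Turnstile>\<^sup>d \<phi>) else g 0,
         if \<exists>S \<in> snd (snd M). (M, h, H(x := S) \<Turnstile>\<^sup>d \<phi>)
         then SOME S. S \<in> snd (snd M) \<and> (M, h, H(x := S) \<Turnstile>\<^sup>d \<phi>) else G 0))"

lemma override_exI:
  assumes "range h \<subseteq> range v" and "\<forall>n\<ge>N. h n = f n"
  shows "\<exists>ts. h = override f (map v ts)"
proof
  have "v (inv v (h n)) = h n" for n
    using assms(1) by (intro f_inv_into_f) auto
  \<comment> \<open>One preimage under \<open>v\<close> for each position below \<open>N\<close>
    suffices, since \<open>h\<close> equals \<open>f\<close> from \<open>N\<close> on.\<close>
  then show "h = override f (map v (map (\<lambda>n. inv v (h n)) [0..<N]))"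
    using assms(2) by (auto simp: override_def fun_eq_iff)
qed

lemma skolem_value_mem:
  assumes "range g \<subseteq> D" "range G \<subseteq> E"
  shows "skolem_value (I, D, E) g G t \<in> D \<times> E"
proof (cases t)
  case (Base i)
  then show ?thesis using assms by auto
next
  case (Witness x \<phi> ts Ts)
  have *: "(if \<exists>a\<in>A. P a then SOME a. a \<in> A \<and> P a else b) \<in> A" if "b \<in> A"
    for A :: "'b set" and P b
    using that someI_ex[of "\<lambda>a. a \<in> A \<and> P a"] by auto
  show ?thesis
    unfolding Witness skolem_value.simps Let_def fst_conv snd_conv mem_Times_iff
    using assms by (intro conjI *) auto
qed

lemma eventually_eq_update:
  fixes h f :: "nat \<Rightarrow> 'a"
  assumes "\<exists>N. \<forall>n\<ge>N. h n = f n"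
  shows "\<exists>N. \<forall>n\<ge>N. (h(x := a)) n = f n"
proof -
  obtain N where "\<forall>n\<ge>N. h n = f n"
    using assms by blast
  then have "\<forall>n\<ge>max N (Suc x). (h(x := a)) n = f n"
    by auto
  then show ?thesis ..
qed

text \<open>The Tarski-Vaught argument. Assignments that agree with \<open>g\<close> and
  \<open>G\<close> from some point on are described by finite lists of terms, and updates preserve
  this agreement, so the induction can stay among them.\<close>

lemma sat_skolem_hull:
  fixes I :: "'u interp" and g G
  assumes gD: "range g \<subseteq> D" and GE: "range G \<subseteq> E"
  defines "v \<equiv> skolem_value (I, D, E) g G"
  defines "A \<equiv> range (\<lambda>t. fst (v t))" and "B \<equiv> range (\<lambda>t. snd (v t))"
  assumes "range h \<subseteq> A" "range H \<subseteq> B"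
    and "\<exists>N. \<forall>n\<ge>N. h n = g n" "\<exists>N. \<forall>n\<ge>N. H n = G n"
  shows "((I, A, B), h, H \<Turnstile>\<^sup>d \<phi>) \<longleftrightarrow> ((I, D, E), h, H \<Turnstile>\<^sup>d \<phi>)"
  using assms(6-)
proof (induction \<phi> arbitrary: h H)
  case (Ex x \<phi>)
  \<comment> \<open>Naming \<open>h\<close> and \<open>H\<close> by lists of terms makes the witness
    chosen at this very assignment the value of \<open>Witness x \<phi> ts Ts\<close>.\<close>
  obtain ts Ts where h: "h = override g (map (\<lambda>t. fst (v t)) ts)"
    and H: "H = override G (map (\<lambda>t. snd (v t)) Ts)"
    using Ex.prems override_exI unfolding A_def B_def by metis
  have AD: "A \<subseteq> D"
    using skolem_value_mem[OF gD GE] by (auto simp: A_def v_def mem_Times_iff)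
  have IH: "((I, A, B), h(x := d), H \<Turnstile>\<^sup>d \<phi>) \<longleftrightarrow> ((I, D, E), h(x := d), H \<Turnstile>\<^sup>d \<phi>)" if "d \<in> A" for d
  proof (rule Ex.IH)
    show "range (h(x := d)) \<subseteq> A"
      using Ex.prems(1) that by auto
    show "\<exists>N. \<forall>n\<ge>N. (h(x := d)) n = g n"
      by (rule eventually_eq_update[OF Ex.prems(3)])
  qed (fact Ex.prems)+
  \<comment> \<open>Only this direction calls on Skolem terms; the converse follows from
    \<open>A \<subseteq> D\<close>.\<close>
  have "\<exists>d\<in>A. (I, D, E), h(x := d), H \<Turnstile>\<^sup>d \<phi>" if ex: "\<exists>d\<in>D. (I, D, E), h(x := d), H \<Turnstile>\<^sup>d \<phi>"
  proof -
    have "fst (v (Witness x \<phi> ts Ts)) = (SOME d. d \<in> D \<and> ((I, D, E), h(x := d), H \<Turnstile>\<^sup>d \<phi>))"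
      using ex unfolding h H v_def by (simp add: Let_def comp_def)
    then have "(I, D, E), h(x := fst (v (Witness x \<phi> ts Ts))), H \<Turnstile>\<^sup>d \<phi>"
      using someI_ex[OF ex[unfolded Bex_def]] by simp
    then show ?thesis
      unfolding A_def by blast
  qed
  then show ?case using IH AD by auto
next
  case (Ex2 X \<phi>)
  obtain ts Ts where h: "h = override g (map (\<lambda>t. fst (v t)) ts)"
    and H: "H = override G (map (\<lambda>t. snd (v t)) Ts)"
    using Ex2.prems override_exI unfolding A_def B_def by metis
  have BE: "B \<subseteq> E"
    using skolem_value_mem[OF gD GE] by (auto simp: B_def v_def mem_Times_iff)
  have IH: "((I, A, B), h, H(X := S) \<Turnstile>\<^sup>d \<phi>) \<longleftrightarrow> ((I, D, E), h, H(X := S) \<Turnstile>\<^sup>d \<phi>)" if "S \<in> B" for S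
  proof (rule Ex2.IH)
    show "range (H(X := S)) \<subseteq> B"
      using Ex2.prems(2) that by auto
    show "\<exists>N. \<forall>n\<ge>N. (H(X := S)) n = G n"
      by (rule eventually_eq_update[OF Ex2.prems(4)])
  qed (fact Ex2.prems)+
  have "\<exists>S\<in>B. (I, D, E), h, H(X := S) \<Turnstile>\<^sup>d \<phi>" if ex: "\<exists>S\<in>E. (I, D, E), h, H(X := S) \<Turnstile>\<^sup>d \<phi>"
  proof -
    have "snd (v (Witness X \<phi> ts Ts)) = (SOME S. S \<in> E \<and> ((I, D, E), h, H(X := S) \<Turnstile>\<^sup>d \<phi>))"
      using ex unfolding h H v_def by (simp add: Let_def comp_def)
    then have "(I, D, E), h, H(X := snd (v (Witness X \<phi> ts Ts))) \<Turnstile>\<^sup>d \<phi>"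
      using someI_ex[OF ex[unfolded Bex_def]] by simp
    then show ?thesis
      unfolding B_def by blast
  qed
  then show ?case using IH BE by auto
next
  case (Neg \<phi>)
  then show ?case by (simp only: sat.simps)
next
  case (Conj \<phi> \<psi>)
  then show ?case by (simp only: sat.simps)
qed simp_all

lemma countable_skolem_hull:
  fixes I :: "'u interp" and g G
  assumes "range g \<subseteq> D" "range G \<subseteq> E"
  obtains A B where "countable A" "countable B" "range g \<subseteq> A" "range G \<subseteq> B"
    "\<And>\<phi>. ((I, A, B), g, G \<Turnstile>\<^sup>d \<phi>) \<longleftrightarrow> ((I, D, E), g, G \<Turnstile>\<^sup>d \<phi>)"
proof
  let ?v = "skolem_value (I, D, E) g G"
  show "countable (range (\<lambda>t. fst (?v t)))" "countable (range (\<lambda>t. snd (?v t)))"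
    by simp_all
  have "g i = fst (?v (Base i))" "G i = snd (?v (Base i))" for i
    by simp_all
  then show gA: "range g \<subseteq> range (\<lambda>t. fst (?v t))" and GB: "range G \<subseteq> range (\<lambda>t. snd (?v t))"
    by blast+
  show "((I, range (\<lambda>t. fst (?v t)), range (\<lambda>t. snd (?v t))), g, G \<Turnstile>\<^sup>d \<phi>)
      \<longleftrightarrow> ((I, D, E), g, G \<Turnstile>\<^sup>d \<phi>)" for \<phi>
    by (rule sat_skolem_hull[OF assms gA GB]) simp_all
qed

section \<open>From countable domains to ranges of assignments\<close>

lemma extend_to_enumeration:
  fixes f :: "nat \<Rightarrow> 'a"
  assumes "countable A" "range f \<subseteq> A" "finite V"
  obtains f' where "range f' = A" "\<And>x. x \<in> V \<Longrightarrow> f' x = f x"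
proof -
  obtain N where N: "\<And>x. x \<in> V \<Longrightarrow> x < N"
    using assms(3) finite_nat_set_iff_bounded by auto
  \<comment> \<open>Values below \<open>N\<close>, which cover \<open>V\<close>, are kept; the
    positions from \<open>N\<close> on enumerate \<open>A\<close>, which is nonempty because it
    contains the values of \<open>f\<close>.\<close>
  let ?f = "\<lambda>n. if n < N then f n else from_nat_into A (n - N)"
  have enum: "range (from_nat_into A) = A"
    using assms by (intro range_from_nat_into) auto
  have "range ?f = A"
  proof
    show "range ?f \<subseteq> A"
      using assms(2) enum by auto
    show "A \<subseteq> range ?f"
    proof
      fix a
      assume "a \<in> A"
      then obtain n where "a = from_nat_into A n"
        using enum by blast
      then have "a = ?f (n + N)"
        by simp
      then show "a \<in> range ?f"
        by (rule range_eqI)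
    qed
  qed
  moreover have "?f x = f x" if "x \<in> V" for x
    using N[OF that] by simp
  ultimately show thesis
    by (rule that)
qed

lemma general_valid_iff_range_valid:
  "general_valid TYPE('u) \<phi> \<longleftrightarrow> (\<forall>(I :: 'u interp) g G. (I, range g, range G), g, G \<Turnstile>\<^sup>d \<phi>)"
proof
  assume "general_valid TYPE('u) \<phi>"
  then show "\<forall>(I :: 'u interp) g G. (I, range g, range G), g, G \<Turnstile>\<^sup>d \<phi>"
    unfolding general_valid_def by blast
next
  assume valid: "\<forall>(I :: 'u interp) g G. (I, range g, range G), g, G \<Turnstile>\<^sup>d \<phi>"
  show "general_valid TYPE('u) \<phi>"
    unfolding general_valid_def
  proof (intro allI impI)
    fix I :: "'u interp" and D E and g :: "var \<Rightarrow> 'u" and G :: "var2 \<Rightarrow> 'u set"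
    assume "range g \<subseteq> D" "range G \<subseteq> E"
    then obtain A B where AB: "countable A" "countable B" "range g \<subseteq> A" "range G \<subseteq> B"
      and hull: "((I, A, B), g, G \<Turnstile>\<^sup>d \<phi>) \<longleftrightarrow> ((I, D, E), g, G \<Turnstile>\<^sup>d \<phi>)"
      using countable_skolem_hull by metis
    \<comment> \<open>Changing \<open>g\<close> and \<open>G\<close> outside the finitely many
      variables of \<phi> makes the ranges exactly \<open>A\<close> and \<open>B\<close>, so that
      \<open>valid\<close> applies, while the truth of \<phi> stays the same.\<close>
    obtain g' where g': "range g' = A" "\<And>x. x \<in> vars \<phi> \<Longrightarrow> g' x = g x"
      using extend_to_enumeration[OF AB(1,3)] finite_vars(1) by metis
    obtain G' where G': "range G' = B" "\<And>X. X \<in> vars2 \<phi> \<Longrightarrow> G' X = G X"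
      using extend_to_enumeration[OF AB(2,4)] finite_vars(2) by metis
    have "(I, A, B), g', G' \<Turnstile>\<^sup>d \<phi>"
      using valid g'(1) G'(1) by blast
    then show "(I, D, E), g, G \<Turnstile>\<^sup>d \<phi>"
      using hull sat_cong[of \<phi> g' g G' G, OF g'(2) G'(2)] by simp
  qed
qed

theorem theorem1:
  fixes \<phi> :: mso
  shows "((\<forall>(I :: 'u interp) g G. ((I, range g, range G), g, G \<Turnstile>\<^sup>d \<phi>))
            \<longleftrightarrow> general_valid TYPE('u) \<phi>)
         \<and> (general_valid TYPE('u) \<phi>
            \<longleftrightarrow> (\<forall>(II :: 'u interp) gg GG. min_shallow II gg GG \<phi>))"
  by (simp add: general_valid_iff_range_valid min_shallow_iff_sat)

end
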